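(* Suppose equilibria exist in the scenarios (NS) and (SWH). Then: (i) the equilibrium utility for workers in the scenario (SWH) is higher than that in the scenario (NS), i.e. $\rho^{\mathrm{SWH}}>\rho^{\mathrm{NS}}$; (ii) the total commuting cost in the scenario (SWH) is lower than that in the scenario (NS), i.e. $TC^{\mathrm{SWH}}<TC^{\mathrm{NS}}$.
   Context: Setting. There are locations $1,\dots,I$, indexed by increasing distance from a central business district (CBD). Location $i$ has land area $A_i>0$; each worker consumes one unit of land and there are $\sum_i A_i$ workers in total, so exactly $A_i$ workers live at $i$. Bottleneck capacities satisfy $\mu_1>\dots>\mu_I>0$; put $\mu_{I+1}=0$ and $\bar\mu_i=\mu_i-\mu_{i+1}$. Free-flow travel times are $f_i\ge 0$. Daily wages for office and remote work are $\theta^O>\theta^R$. The schedule delay cost for preferred arrival time $t_k$ is $\beta(t_k-t)$ if $t<t_k$ and $\gamma(t-t_k)$ if $t\ge t_k$, with $0<\beta<1$, $\gamma>0$ and $\gamma<\bar\mu_i/\mu_{i+1}$ for $i<I$; put $\delta=\beta\gamma/(\beta+\gamma)$. Let $K\in\{1,2\}$ be the number of preferred arrival times; for $K=2$ let $d=t_2-t_1>0$. If $X>0$ commuters use capacity $\mu$, the resulting short-term equilibrium commuting cost per trip (excluding free-flow time) is $\bar c_K(X,\mu)=\frac{X}{\mu}\delta-d(K-1)\delta$. Equilibrium. Given a set $\mathcal H\subseteq[0,1]$ of office work ratios and $K$, an equilibrium consists of an index $i^*\in\{1,\dots,I\}$, office work ratios $\eta(i)\in\mathcal H$ (all workers at $i$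 choose $\eta(i)$), land rents $r_i\ge0$ with $r_I=0$, costs $\kappa_i$, and a utility $\rho\in\mathbb R$ such that, with $X_i=\eta(i)A_i$: (a) $\eta(i)>0$ if and only if $i\le i^*$; (b) $\kappa_i=\bar c_K(X_i,\bar\mu_i)$ for $i\le i^*$, $\kappa_1<\dots<\kappa_{i^*}$, and $\kappa_i\ge\kappa_{i^*}$ for $i>i^*$; (c) if $K=2$, then $\kappa_i\ge d\delta$ for $i\le i^*$ (equivalently, the arrival time windows are intervals); (d) for all $i$ and all $h\in\mathcal H$, $h\big(\theta^O-\kappa_i-\sum_{j\le i}f_j\big)+(1-h)\theta^R-r_i\le\rho$, with equality for $h=\eta(i)$; (e) if $\mathcal H=[0,1]$, then $0<\eta(i^* )<1$ (location $i^*$ is the mixed zone). The equilibrium commuting cost $\lambda_i(\eta(i))$ is $\kappa_i$ for $i\le i^*$ and $0$ for $i>i^*$ (nobody commutes there). The total commuting cost is $TC=\sum_i\lambda_i(\eta(i))\,\eta(i)A_i$. Scenarios (all other parameters being the same), indicated by superscripts: (NS) no schemes: $\mathcal H=\{1\}$, $K=1$; (SWH) staggered work hours: $\mathcal H=\{1\}$, $K=2$. *)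

theory Defs
  imports Complex_Main
begin

text \<open>
  Locations are the natural numbers \<open>1, \<dots>, nloc C\<close>; all location-indexed functions are only
  meaningful on that range.
\<close>

record city =
  nloc :: nat                     \<comment> \<open>\<open>I\<close>\<close>
  area :: "nat \<Rightarrow> real"           \<comment> \<open>\<open>A\<^sub>i\<close>\<close>
  capacity :: "nat \<Rightarrow> real"       \<comment> \<open>\<open>\<mu>\<^sub>i\<close>\<close>
  freeflow :: "nat \<Rightarrow> real"       \<comment> \<open>\<open>f\<^sub>i\<close>\<close>
  wage_office :: real             \<comment> \<open>\<open>\<theta>\<close> for office work\<close>
  wage_remote :: real             \<comment> \<open>\<open>\<theta>\<close> for remote work\<close>
  early_cost :: real              \<comment> \<open>\<open>\<beta>\<close>\<close>
  late_cost :: real               \<comment> \<open>\<open>\<gamma>\<close>\<close>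
  pref_time1 :: real              \<comment> \<open>\<open>t\<^sub>1\<close>\<close>
  pref_time2 :: real              \<comment> \<open>\<open>t\<^sub>2\<close>, used only with two preferred arrival times\<close>

text \<open>The convention that the capacity beyond the last location is zero is built in here.\<close>

definition capacity_gap :: "city \<Rightarrow> nat \<Rightarrow> real" where
  "capacity_gap C i = capacity C i - (if i = nloc C then 0 else capacity C (Suc i))"

definition valid_city :: "city \<Rightarrow> bool" where
  "valid_city C \<longleftrightarrow>
     1 \<le> nloc C \<and>
     (\<forall>i\<in>{1..nloc C}. 0 < area C i) \<and>
     (\<forall>i\<in>{1..nloc C}. 0 < capacity C i) \<and>
     (\<forall>i\<in>{1..<nloc C}. capacity C (Suc i) < capacity C i) \<and>
     (\<forall>i\<in>{1..nloc C}. 0 \<le> freeflow C i) \<and>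
     wage_remote C < wage_office C \<and>
     0 < early_cost C \<and> early_cost C < 1 \<and>
     0 < late_cost C \<and>
     (\<forall>i\<in>{1..<nloc C}. late_cost C < capacity_gap C i / capacity C (Suc i)) \<and>
     pref_time1 C < pref_time2 C"

definition delta :: "city \<Rightarrow> real" where
  "delta C = early_cost C * late_cost C / (early_cost C + late_cost C)"

definition time_gap :: "city \<Rightarrow> real" where
  "time_gap C = pref_time2 C - pref_time1 C"

text \<open>
  The short-term equilibrium commuting cost per trip, free-flow time excluded, when \<open>X > 0\<close>
  commuters with \<open>K\<close> preferred arrival times use a bottleneck capacity \<open>m\<close>.
\<close>

definition short_term_cost :: "city \<Rightarrow> nat \<Rightarrow> real \<Rightarrow> real \<Rightarrow> real" where
  "short_term_cost C K X m = X / m * delta C - time_gap C * (real K - 1) * delta C"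

record allocation =
  boundary :: nat                 \<comment> \<open>\<open>i\<^sup>*\<close>, the last location with office commuters\<close>
  office_ratio :: "nat \<Rightarrow> real"   \<comment> \<open>\<open>\<eta>(i)\<close>\<close>
  rent :: "nat \<Rightarrow> real"           \<comment> \<open>\<open>r\<^sub>i\<close>\<close>
  cost :: "nat \<Rightarrow> real"           \<comment> \<open>\<open>\<kappa>\<^sub>i\<close>\<close>
  utility :: real                 \<comment> \<open>\<open>\<rho>\<close>\<close>

definition commuters :: "city \<Rightarrow> allocation \<Rightarrow> nat \<Rightarrow> real" where
  "commuters C E i = office_ratio E i * area C i"

text \<open>The utility of a worker at \<open>i\<close> with office work ratio \<open>h\<close>, at the costs and rents of \<open>E\<close>.\<close>

definition worker_utility :: "city \<Rightarrow> allocation \<Rightarrow> nat \<Rightarrow> real \<Rightarrow> real" where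
  "worker_utility C E i h =
     h * (wage_office C - cost E i - (\<Sum>j\<in>{1..i}. freeflow C j))
     + (1 - h) * wage_remote C - rent E i"

definition equilibrium :: "city \<Rightarrow> real set \<Rightarrow> nat \<Rightarrow> allocation \<Rightarrow> bool" where
  "equilibrium C H K E \<longleftrightarrow>
     H \<subseteq> {0..1} \<and> K \<in> {1, 2} \<and>
     boundary E \<in> {1..nloc C} \<and>
     (\<forall>i\<in>{1..nloc C}. office_ratio E i \<in> H) \<and>
     (\<forall>i\<in>{1..nloc C}. 0 \<le> rent E i) \<and> rent E (nloc C) = 0 \<and>
     (\<forall>i\<in>{1..nloc C}. 0 < office_ratio E i \<longleftrightarrow> i \<le> boundary E) \<and>
     (\<forall>i\<in>{1..boundary E}.
        cost E i = short_term_cost C K (commuters C E i) (capacity_gap C i)) \<and>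
     strict_mono_on {1..boundary E} (cost E) \<and>
     (\<forall>i\<in>{boundary E<..nloc C}. cost E (boundary E) \<le> cost E i) \<and>
     (K = 2 \<longrightarrow> (\<forall>i\<in>{1..boundary E}. time_gap C * delta C \<le> cost E i)) \<and>
     (\<forall>i\<in>{1..nloc C}. \<forall>h\<in>H. worker_utility C E i h \<le> utility E) \<and>
     (\<forall>i\<in>{1..nloc C}. worker_utility C E i (office_ratio E i) = utility E) \<and>
     (H = {0..1} \<longrightarrow> 0 < office_ratio E (boundary E) \<and> office_ratio E (boundary E) < 1)"

text \<open>
  Beyond the boundary nobody commutes: the equilibrium commuting cost is zero there, although
  \<open>cost E i\<close> (the cost a deviating commuter would face) need not be.
\<close>

definition commuting_cost :: "allocation \<Rightarrow> nat \<Rightarrow> real" where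
  "commuting_cost E i = (if i \<le> boundary E then cost E i else 0)"

definition total_commuting_cost :: "city \<Rightarrow> allocation \<Rightarrow> real" where
  "total_commuting_cost C E =
     (\<Sum>i\<in>{1..nloc C}. commuting_cost E i * office_ratio E i * area C i)"

definition NS_equilibrium :: "city \<Rightarrow> allocation \<Rightarrow> bool" where
  "NS_equilibrium C E \<longleftrightarrow> equilibrium C {1} 1 E"

definition SWH_equilibrium :: "city \<Rightarrow> allocation \<Rightarrow> bool" where
  "SWH_equilibrium C E \<longleftrightarrow> equilibrium C {1} 2 E"

end

theory Submission
  imports Defs
begin

text \<open>
  With \<open>H = {1}\<close> everybody works at the office, so both scenarios have the same commuters everywhere
  and the second preferred arrival time lowers every commuting cost by the constant \<open>d \<delta> > 0\<close>.
  The utility is read off at the last location, where the rent vanishes.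
\<close>

lemma office_only_ratio:
  assumes "equilibrium C {1} K E" "i \<in> {1..nloc C}"
  shows "office_ratio E i = 1"
  using assms unfolding equilibrium_def by blast

text \<open>The ratio at the last location is 1, hence positive, and positive ratios occur only up
  to the boundary.\<close>

lemma office_only_boundary:
  assumes "equilibrium C {1} K E"
  shows "boundary E = nloc C"
proof -
  have b: "boundary E \<in> {1..nloc C}"
    and pos: "\<And>i. i \<in> {1..nloc C} \<Longrightarrow> 0 < office_ratio E i \<longleftrightarrow> i \<le> boundary E"
    using assms unfolding equilibrium_def by blast+
  have last: "nloc C \<in> {1..nloc C}" using b by simp
  show ?thesis using pos[OF last] office_only_ratio[OF assms last] b by simp
qed

text \<open>An equilibrium fixes costs by the bottleneck formula only up to the boundary, which here
  is the last location. The right-hand side depends on the scenario only through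
  \<open>K\<close>.\<close>

lemma office_only_cost:
  assumes "equilibrium C {1} K E" "i \<in> {1..nloc C}"
  shows "cost E i = short_term_cost C K (area C i) (capacity_gap C i)"
proof -
  have "cost E i = short_term_cost C K (commuters C E i) (capacity_gap C i)"
    using assms office_only_boundary[OF assms(1)] unfolding equilibrium_def by metis
  then show ?thesis using office_only_ratio[OF assms] by (simp add: commuters_def)
qed

lemma office_only_utility:
  assumes "equilibrium C {1} K E"
  shows "utility E = wage_office C - cost E (nloc C) - (\<Sum>j\<in>{1..nloc C}. freeflow C j)"
proof -
  have last: "nloc C \<in> {1..nloc C}" and rent: "rent E (nloc C) = 0"
    and "\<And>i. i \<in> {1..nloc C} \<Longrightarrow> worker_utility C E i (office_ratio E i) = utility E"
    using assms unfolding equilibrium_def by auto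
  then have "worker_utility C E (nloc C) 1 = utility E"
    using office_only_ratio[OF assms last] by metis
  then show ?thesis using rent by (simp add: worker_utility_def)
qed

text \<open>With the boundary at the last location, the zero branch of \<open>commuting_cost\<close>
  never occurs.\<close>

lemma office_only_total_cost:
  assumes "equilibrium C {1} K E"
  shows "total_commuting_cost C E = (\<Sum>i\<in>{1..nloc C}. cost E i * area C i)"
  unfolding total_commuting_cost_def commuting_cost_def
  using office_only_ratio[OF assms] office_only_boundary[OF assms] by (intro sum.cong) auto

theorem theorem1:
  fixes C :: city and NS SWH :: allocation
  assumes "valid_city C"
    and "NS_equilibrium C NS"
    and "SWH_equilibrium C SWH"
  shows "utility SWH > utility NS
    \<and> total_commuting_cost C SWH < total_commuting_cost C NS"
proof -
  have ns: "equilibrium C {1} 1 NS" and swh: "equilibrium C {1} 2 SWH"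
    using assms by (simp_all add: NS_equilibrium_def SWH_equilibrium_def)
  have n: "nloc C \<in> {1..nloc C}" and area: "\<And>i. i \<in> {1..nloc C} \<Longrightarrow> 0 < area C i"
    and "0 < time_gap C * delta C"
    using assms(1) by (auto simp: valid_city_def time_gap_def delta_def)
  \<comment> \<open>The factor \<open>real K - 1\<close> is 0 for NS and 1 for SWH, so the costs
    differ by exactly \<open>time_gap C * delta C\<close>.\<close>
  then have cost: "cost SWH i < cost NS i" if "i \<in> {1..nloc C}" for i
    using office_only_cost[OF ns that] office_only_cost[OF swh that]
    by (simp add: short_term_cost_def)
  have "utility NS < utility SWH"
    using cost[OF n] office_only_utility[OF ns] office_only_utility[OF swh] by simp
  moreover have "total_commuting_cost C SWH < total_commuting_cost C NS"
    unfolding office_only_total_cost[OF ns] office_only_total_cost[OF swh]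
    \<comment> \<open>Here \<open>n\<close> serves to show that the index set is nonempty, without
      which the sums would not differ strictly.\<close>
    using n cost area by (intro sum_strict_mono mult_strict_right_mono) auto
  ultimately show ?thesis by simp
qed

end
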